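(* Let $p$ be an odd prime. For a finite group $G$, the following are equivalent: (i) $G$ is section $p$-stable. (ii) All sections of $G$ are $p$-stable. (iii) $N_G(R)/R$ is $p$-stable for all $p$-subgroups $R$ of $G$.
   Context: A finite group $G$ is called $p$-stable if for every $p$-subgroup $Q$ of $G$ and every $x \in N_G(Q)$ with $[Q,x,x]=1$, the coset $xC_G(Q)$ lies in $O_p\big(N_G(Q)/C_G(Q)\big)$. Here $[Q,x,x]=[[Q,x],x]$. A section of $G$ is a group $H/K$ with $K\triangleleft H\le G$. For $p$-subgroups $R \triangleleft Q$ of $G$ put $N_G(Q/R)=N_G(Q)\cap N_G(R)$ and $C_G(Q/R)=\{x\in N_G(Q/R)\mid [Q,x]\subseteq R\}$. $G$ is section $p$-stable if for all $p$-subgroups $R$ and $Q$ of $G$ with $R\triangleleft Q$, whenever $x\in N_G(Q/R)$ satisfies $[Q,x,x]\subseteq R$, then $xC_G(Q/R)\in O_p\big(N_G(Q/R)/C_G(Q/R)\big)$. *)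

theory Defs
  imports "HOL-Algebra.Group_Action" "HOL-Algebra.Generated_Groups" "HOL-Computational_Algebra.Primes"
begin

definition p_subgroup :: "nat \<Rightarrow> ('a, 'b) monoid_scheme \<Rightarrow> 'a set \<Rightarrow> bool" where
  "p_subgroup p G Q \<longleftrightarrow> subgroup Q G \<and> (\<exists>n. card Q = p ^ n)"

(* O_p(G), the largest normal p-subgroup, as the join of all normal p-subgroups. *)
definition p_core :: "nat \<Rightarrow> ('a, 'b) monoid_scheme \<Rightarrow> 'a set" where
  "p_core p G = generate G (\<Union>{N. N \<lhd> G \<and> p_subgroup p G N})"

definition centralizer :: "('a, 'b) monoid_scheme \<Rightarrow> 'a set \<Rightarrow> 'a set" where
  "centralizer G Q = {x \<in> carrier G. \<forall>q\<in>Q. x \<otimes>\<^bsub>G\<^esub> q = q \<otimes>\<^bsub>G\<^esub> x}"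

(* [Q, x]: the subgroup generated by the commutators [q, x] = q^-1 x^-1 q x with q in Q.
   The other convention, q x q^-1 x^-1, generates the same subgroup when Q is a subgroup
   normalized by x. *)
definition commutator_subgroup :: "('a, 'b) monoid_scheme \<Rightarrow> 'a set \<Rightarrow> 'a \<Rightarrow> 'a set" where
  "commutator_subgroup G Q x =
     generate G {inv\<^bsub>G\<^esub> q \<otimes>\<^bsub>G\<^esub> inv\<^bsub>G\<^esub> x \<otimes>\<^bsub>G\<^esub> q \<otimes>\<^bsub>G\<^esub> x | q. q \<in> Q}"

(* The left coset x C_G(Q) is also the right coset C_G(Q) x, since C_G(Q) is normal in
   N_G(Q); so it is an element of the carrier of the quotient built by Mod.
   The same applies to section_p_stable. *)
definition p_stable :: "nat \<Rightarrow> ('a, 'b) monoid_scheme \<Rightarrow> bool" where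
  "p_stable p G \<longleftrightarrow>
     (\<forall>Q x. p_subgroup p G Q \<longrightarrow> x \<in> normalizer G Q \<longrightarrow>
        commutator_subgroup G (commutator_subgroup G Q x) x = {\<one>\<^bsub>G\<^esub>} \<longrightarrow>
        x <#\<^bsub>G\<^esub> centralizer G Q
          \<in> p_core p (G\<lparr>carrier := normalizer G Q\<rparr> Mod centralizer G Q))"

definition sections :: "('a, 'b) monoid_scheme \<Rightarrow> 'a set monoid set" where
  "sections G = {G\<lparr>carrier := H\<rparr> Mod K | H K. subgroup H G \<and> K \<lhd> G\<lparr>carrier := H\<rparr>}"

definition section_normalizer :: "('a, 'b) monoid_scheme \<Rightarrow> 'a set \<Rightarrow> 'a set \<Rightarrow> 'a set" where
  "section_normalizer G Q R = normalizer G Q \<inter> normalizer G R"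

definition section_centralizer :: "('a, 'b) monoid_scheme \<Rightarrow> 'a set \<Rightarrow> 'a set \<Rightarrow> 'a set" where
  "section_centralizer G Q R = {x \<in> section_normalizer G Q R. commutator_subgroup G Q x \<subseteq> R}"

definition section_p_stable :: "nat \<Rightarrow> ('a, 'b) monoid_scheme \<Rightarrow> bool" where
  "section_p_stable p G \<longleftrightarrow>
     (\<forall>Q R x. p_subgroup p G Q \<longrightarrow> p_subgroup p G R \<longrightarrow> R \<lhd> G\<lparr>carrier := Q\<rparr> \<longrightarrow>
        x \<in> section_normalizer G Q R \<longrightarrow>
        commutator_subgroup G (commutator_subgroup G Q x) x \<subseteq> R \<longrightarrow>
        x <#\<^bsub>G\<^esub> section_centralizer G Q R
          \<in> p_core p (G\<lparr>carrier := section_normalizer G Q R\<rparr> Mod section_centralizer G Q R))"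

end

(* By Cauchy's theorem, x C lies in O_p(N/C) iff x lies in a normal subgroup M of N each of whose
   elements has some p-power power in C. This criterion pulls back along homomorphisms and pushes
   forward along surjective ones.

   For R normal in Q, the groups N_G(Q/R) and C_G(Q/R) are the preimages of the normalizer and the
   centralizer of Q/R in N_G(R)/R, so stability of N_G(R)/R pulls back to G.
   Conversely, let P be a p-subgroup of a section H/K. A Sylow subgroup Q of the preimage of P maps
   onto P, and by the Frattini argument N_H(Q) maps onto the normalizer of P. Section stability for
   the pair (Q, Q \<inter> K) then restricts to N_H(Q) and pushes forward to H/K. *)

theory Submission
  imports Defs "HOL-Algebra.Sylow" "HOL-Algebra.SndIsomorphismGrp"
    "HOL-Algebra.Multiplicative_Group" "HOL-Algebra.Zassenhaus"
begin

subsection \<open>Homomorphisms and \<open>p\<close>-groups\<close>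

lemma (in group_hom) subgroup_vimage:
  assumes "subgroup B H"
  shows "subgroup {g \<in> carrier G. h g \<in> B} G"
proof -
  interpret B: subgroup B H by fact
  show ?thesis by (rule G.subgroupI) (auto intro: exI[of _ "\<one>"])
qed

lemma (in group_hom) normal_vimage:
  assumes "N \<lhd> H"
  shows "{g \<in> carrier G. h g \<in> N} \<lhd> G"
proof -
  interpret N: normal N H by fact
  show ?thesis
    unfolding G.normal_inv_iff
    using subgroup_vimage[OF N.subgroup_axioms] by (auto intro: N.inv_op_closed2)
qed

lemma (in group_hom) normal_image:
  assumes "N \<lhd> G" "h ` carrier G = carrier H"
  shows "h ` N \<lhd> H"
proof -
  interpret N: normal N G by fact
  have "h g \<otimes>\<^bsub>H\<^esub> h n \<otimes>\<^bsub>H\<^esub> inv\<^bsub>H\<^esub> (h g) \<in> h ` N" if "g \<in> carrier G" "n \<in> N" for g n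
    using that N.inv_op_closed2[OF that] by (auto intro!: image_eqI[of _ _ "g \<otimes> n \<otimes> inv g"])
  then show ?thesis
    unfolding H.normal_inv_iff assms(2)[symmetric]
    using subgroup_img_is_subgroup[OF N.subgroup_axioms] by blast
qed

text \<open>The first isomorphism theorem followed by Lagrange's theorem. The codomain is cut down
  to the image of \<open>h\<close>, where \<open>h\<close> becomes surjective.\<close>

lemma (in group_hom) card_image_mult_kernel:
  assumes "finite (carrier G)"
  shows "card (h ` carrier G) * card (kernel G H h) = order G"
proof -
  let ?I = "H\<lparr>carrier := h ` carrier G\<rparr>"
  have "subgroup (h ` carrier G) H" by (rule img_is_subgroup)
  then interpret I: group ?I by (rule H.subgroup_imp_group)
  interpret hI: group_hom G ?I h
    by unfold_locales (auto simp: hom_def)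
  have "kernel G ?I h = kernel G H h" by (simp add: kernel_def)
  moreover have "G Mod kernel G ?I h \<cong> ?I"
    by (rule hI.FactGroup_iso) simp
  then have "order (G Mod kernel G ?I h) = order ?I"
    by (auto simp: is_iso_def dest: iso_same_order)
  ultimately have "card (h ` carrier G) = card (rcosets (kernel G H h))"
    by (simp add: order_def FactGroup_def)
  then show ?thesis
    using G.lagrange[OF subgroup_kernel] by simp
qed

section \<open>Finite p-groups described by the orders of their elements\<close>

lemma (in group) pow_card_subgroup:
  assumes "subgroup P G" "x \<in> P"
  shows "x [^] card P = \<one>"
  using group.pow_order_eq_1[OF subgroup_imp_group[OF assms(1)], of x] assms(2)
  by (simp add: order_def flip: nat_pow_consistent)

text \<open>The forward direction is that every element is killed by the group order. For the
  converse, a prime q \<noteq> p dividing the order yields a nontrivial element whose order divides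
  both q and a power of p, which is impossible.\<close>

lemma (in group) card_prime_power_iff:
  fixes p :: nat
  assumes "Factorial_Ring.prime p" "finite (carrier G)"
  shows "(\<exists>n. order G = p ^ n) \<longleftrightarrow> (\<forall>x\<in>carrier G. \<exists>n. x [^] (p ^ n) = \<one>)"
proof
  assume "\<exists>n. order G = p ^ n"
  then show "\<forall>x\<in>carrier G. \<exists>n. x [^] (p ^ n) = \<one>"
    by (metis pow_order_eq_1)
next
  assume elts: "\<forall>x\<in>carrier G. \<exists>n. x [^] (p ^ n) = \<one>"
  have "q = p" if q: "Factorial_Ring.prime q" "q dvd order G" for q
  proof (rule ccontr)
    assume "q \<noteq> p"
    \<comment> \<open>With exponent 1, Sylow's theorem becomes Cauchy's theorem: it gives a subgroup
      of order exactly q.\<close>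
    from q(2) obtain m where "order G = q ^ 1 * m" by (auto elim: dvdE)
    from sylow_thm[OF q(1) is_group this assms(2)]
    obtain P where P: "subgroup P G" "card P = q" by auto
    have "P \<noteq> {\<one>}" using P(2) q(1) by (auto dest: prime_gt_1_nat)
    then obtain x where x: "x \<in> P" "x \<noteq> \<one>"
      using subgroup.one_closed[OF P(1)] by blast
    then have xc: "x \<in> carrier G" using subgroup.subset[OF P(1)] by blast
    with elts obtain n where "x [^] (p ^ n) = \<one>" by blast
    then have "ord x dvd p ^ n" using pow_eq_id[OF xc] by blast
    moreover have "ord x dvd q"
      using pow_card_subgroup[OF P(1) x(1)] P(2) pow_eq_id[OF xc] by simp
    moreover have "coprime (p ^ n) q"
      using assms(1) q(1) \<open>q \<noteq> p\<close> by (simp add: primes_coprime)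
    ultimately have "ord x = 1" by (meson coprime_common_divisor nat_dvd_1_iff_1)
    then show False using x(2) xc ord_eq_1 by blast
  qed
  moreover have nz: "order G \<noteq> 0" using assms(2) order_gt_0_iff_finite by simp
  from nz obtain m where m: "order G = p ^ multiplicity p (order G) * m" "\<not> p dvd m"
    using assms(1) by (metis multiplicity_decompose' not_prime_unit)
  \<comment> \<open>A prime factor of \<open>m\<close> would divide the group order, hence equal p,
    but p does not divide \<open>m\<close>.\<close>
  ultimately have "m = 1"
    by (metis dvd_mult prime_factor_nat)
  with m(1) have "order G = p ^ multiplicity p (order G)" by simp
  then show "\<exists>n. order G = p ^ n" by blast
qed

text \<open>The elementwise form passes to images and products by computing powers, with no counting
  of orders.\<close>

lemma (in group) p_subgroup_iff:
  assumes "Factorial_Ring.prime p" "finite (carrier G)"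
  shows "p_subgroup p G P \<longleftrightarrow> subgroup P G \<and> (\<forall>x\<in>P. \<exists>n. x [^] (p ^ n) = \<one>)"
proof (cases "subgroup P G")
  case True
  then have "finite P" using assms(2) by (meson finite_subset subgroup.subset)
  then show ?thesis
    using group.card_prime_power_iff[OF subgroup_imp_group[OF True] assms(1)] True
    by (simp add: p_subgroup_def order_def flip: nat_pow_consistent)
qed (simp add: p_subgroup_def)

subsection \<open>The \<open>p\<close>-core modulo a normal subgroup\<close>

text \<open>Modulo \<open>M\<close> the product m x equals x, so some p-power of it lies in
  \<open>M\<close>, and a further p-power of that is trivial.\<close>

lemma (in group) p_subgroup_normal_mult:
  assumes p: "Factorial_Ring.prime p" and fin: "finite (carrier G)"
    and M: "M \<lhd> G" "p_subgroup p G M" and P: "p_subgroup p G P"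
  shows "p_subgroup p G (M <#> P)"
proof -
  interpret M: normal M G by fact
  have sP: "subgroup P G" using P by (simp add: p_subgroup_def)
  interpret MP: second_isomorphism_grp M G P
    by (intro second_isomorphism_grp.intro M.normal_axioms second_isomorphism_grp_axioms.intro sP)
  have "\<exists>k. (m \<otimes> x) [^] (p ^ k) = \<one>" if mx: "m \<in> M" "x \<in> P" for m x
  proof -
    from mx have c: "m \<in> carrier G" "x \<in> carrier G" "m \<otimes> x \<in> carrier G"
      using subgroup.subset[OF sP] M.subset by blast+
    obtain k where k: "x [^] (p ^ k) = \<one>"
      using P mx(2) p_subgroup_iff[OF p fin] by blast
    have "M #> (m \<otimes> x) = M #> x"
      using c coset_join2[OF c(1) M.subgroup_axioms mx(1)] coset_mult_assoc[OF M.subset c(1,2)] by simp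
    then have "M #> ((m \<otimes> x) [^] (p ^ k)) = M #> \<one>"
      using c k by (metis M.FactGroup_pow)
    then have "(m \<otimes> x) [^] (p ^ k) \<in> M"
      using rcos_self[OF nat_pow_closed[OF c(3), of "p ^ k"] M.subgroup_axioms] M.subset by simp
    then obtain l where "((m \<otimes> x) [^] (p ^ k)) [^] (p ^ l) = \<one>"
      using M(2) p_subgroup_iff[OF p fin] by blast
    then show ?thesis
      using c by (metis nat_pow_pow power_add)
  qed
  then show ?thesis
    unfolding p_subgroup_iff[OF p fin] using MP.normal_set_mult_subgroup
    by (auto simp: set_mult_def)
qed

text \<open>Take a normal p-subgroup \<open>M\<close> of maximal order. For any other one
  \<open>N\<close>, the product \<open>M <#> N\<close> is again a normal p-subgroup, so maximality
  forces N into M. The union of all of them is therefore already \<open>M\<close>, and generating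
  adds nothing.\<close>

lemma (in group) p_core_normal_p_subgroup:
  assumes p: "Factorial_Ring.prime p" and fin: "finite (carrier G)"
  shows "p_core p G \<lhd> G \<and> p_subgroup p G (p_core p G)"
proof -
  let ?S = "{N. N \<lhd> G \<and> p_subgroup p G N}"
  have sub: "N \<subseteq> carrier G" if "N \<in> ?S" for N
    using that by (auto dest: normal_imp_subgroup subgroup.mem_carrier)
  then have \<open>finite ?S\<close>
    using fin by (meson PowI finite_Pow_iff finite_subset subsetI)
  \<comment> \<open>The trivial subgroup, of order p^0, makes the family nonempty, so the maximum is
    attained.\<close>
  moreover have "{\<one>} \<in> ?S"
    using one_is_normal by (auto simp: p_subgroup_def normal_def intro: exI[of _ 0])
  ultimately have "Max (card ` ?S) \<in> card ` ?S" by (intro Max_in) auto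
  then obtain M where M: "M \<in> ?S" "card M = Max (card ` ?S)" by force
  have max: "card N \<le> card M" if "N \<in> ?S" for N
    unfolding M(2) using \<open>finite ?S\<close> that by (intro Max_ge finite_imageI imageI)
  interpret M: normal M G using M(1) by simp
  have "N \<subseteq> M" if N: "N \<in> ?S" for N
  proof -
    interpret N: normal N G using N by simp
    interpret MN: second_isomorphism_grp M G N
      by (intro second_isomorphism_grp.intro M.normal_axioms
          second_isomorphism_grp_axioms.intro N.subgroup_axioms)
    have sub_MN: "M \<subseteq> M <#> N" "N \<subseteq> M <#> N"
      using MN.H_contained_in_set_mult MN.S_contained_in_set_mult by auto
    have "M <#> N \<in> ?S"
    proof -
      have "g \<otimes> (m \<otimes> n) \<otimes> inv g \<in> M <#> N" if "g \<in> carrier G" "m \<in> M" "n \<in> N" for g m n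
      proof -
        have "g \<otimes> (m \<otimes> n) \<otimes> inv g = (g \<otimes> m \<otimes> inv g) \<otimes> (g \<otimes> n \<otimes> inv g)"
          using that M.subset N.subset by (simp add: m_assoc inv_solve_left subset_iff)
        then show ?thesis
          using M.inv_op_closed2[OF that(1,2)] N.inv_op_closed2[OF that(1,3)]
          unfolding set_mult_def by blast
      qed
      moreover have "p_subgroup p G (M <#> N)"
        using p_subgroup_normal_mult[OF p fin] M(1) N by blast
      ultimately show ?thesis
        unfolding normal_inv_iff p_subgroup_def by (auto simp: set_mult_def)
    qed
    then have "card (M <#> N) \<le> card M" "M <#> N \<subseteq> carrier G" using max sub by blast+
    then have "M <#> N = M"
      using sub_MN(1) fin by (metis card_seteq finite_subset)
    with sub_MN(2) show ?thesis by simp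
  qed
  then have union: "\<Union>?S = M" using M(1) by blast
  have "p_core p G = M"
    unfolding p_core_def union
    using generate_subgroup_incl[OF order_refl M.subgroup_axioms] by (auto intro: generate.incl)
  with M(1) show ?thesis by simp
qed

text \<open>One witness is the core itself, by the preceding lemma. Conversely, any such
  \<open>M\<close> is a normal p-subgroup and so occurs among the generators of the core.\<close>

lemma (in group) p_core_iff:
  assumes p: "Factorial_Ring.prime p" and fin: "finite (carrier G)"
  shows "x \<in> p_core p G \<longleftrightarrow> (\<exists>M. M \<lhd> G \<and> x \<in> M \<and> (\<forall>m\<in>M. \<exists>n. m [^] (p ^ n) = \<one>))"
proof
  assume "x \<in> p_core p G"
  then show "\<exists>M. M \<lhd> G \<and> x \<in> M \<and> (\<forall>m\<in>M. \<exists>n. m [^] (p ^ n) = \<one>)"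
    using p_core_normal_p_subgroup[OF p fin] p_subgroup_iff[OF p fin] by blast
next
  assume "\<exists>M. M \<lhd> G \<and> x \<in> M \<and> (\<forall>m\<in>M. \<exists>n. m [^] (p ^ n) = \<one>)"
  then show "x \<in> p_core p G"
    unfolding p_core_def using p_subgroup_iff[OF p fin]
    by (auto intro!: generate.incl dest: normal_imp_subgroup)
qed

text \<open>The subgroup \<open>M\<close> is not required to contain \<open>C\<close>; when \<open>C\<close> is normal, replacing \<open>M\<close> by \<open>MC\<close>
  would not affect the condition.\<close>

definition p_radical_modulo :: "nat \<Rightarrow> ('a, 'b) monoid_scheme \<Rightarrow> 'a set \<Rightarrow> 'a \<Rightarrow> bool" where
  "p_radical_modulo p G C x \<longleftrightarrow>
     (\<exists>M. M \<lhd> G \<and> x \<in> M \<and> (\<forall>m\<in>M. \<exists>n. m [^]\<^bsub>G\<^esub> (p ^ n) \<in> C))"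

text \<open>The witness is the image of \<open>M\<close>, which is normal because \<open>h\<close>
  is onto; powers commute with \<open>h\<close>.\<close>

lemma (in group_hom) p_radical_modulo_image:
  assumes "p_radical_modulo p G C x" "h ` carrier G = carrier H"
    and "\<And>c. c \<in> C \<Longrightarrow> c \<in> carrier G \<Longrightarrow> h c \<in> D"
  shows "p_radical_modulo p H D (h x)"
proof -
  obtain M where M: "M \<lhd> G" "x \<in> M" "\<And>m. m \<in> M \<Longrightarrow> \<exists>n. m [^] (p ^ n) \<in> C"
    using assms(1) unfolding p_radical_modulo_def by blast
  interpret M: normal M G by fact
  have "\<exists>n. h m [^]\<^bsub>H\<^esub> (p ^ n) \<in> D" if "m \<in> M" for m
    using M(3)[OF that] assms(3) that by (metis G.nat_pow_closed M.mem_carrier hom_nat_pow)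
  then show ?thesis
    unfolding p_radical_modulo_def
    using normal_image[OF M(1) assms(2)] M(2) by blast
qed

text \<open>The witness is the preimage of \<open>M\<close>. Applied to the inclusion of a subgroup,
  this restricts the criterion to that subgroup.\<close>

lemma (in group_hom) p_radical_modulo_vimage:
  assumes "p_radical_modulo p H D (h x)" "x \<in> carrier G"
    and "\<And>c. c \<in> carrier G \<Longrightarrow> h c \<in> D \<Longrightarrow> c \<in> C"
  shows "p_radical_modulo p G C x"
proof -
  obtain M where M: "M \<lhd> H" "h x \<in> M" "\<And>m. m \<in> M \<Longrightarrow> \<exists>n. m [^]\<^bsub>H\<^esub> (p ^ n) \<in> D"
    using assms(1) unfolding p_radical_modulo_def by blast
  have "\<exists>n. m [^] (p ^ n) \<in> C" if "m \<in> carrier G" "h m \<in> M" for m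
    using M(3)[OF that(2)] assms(3) that(1) by (metis G.nat_pow_closed hom_nat_pow)
  then show ?thesis
    unfolding p_radical_modulo_def
    using normal_vimage[OF M(1)] M(2) assms(2)
    by (intro exI[of _ "{g \<in> carrier G. h g \<in> M}"]) blast
qed

section \<open>Membership in the p-core of a quotient\<close>

lemma (in normal) group_hom_r_coset: "group_hom G (G Mod H) (\<lambda>x. H #> x)"
  by (simp add: group_hom_def group_hom_axioms_def is_group factorgroup_is_group r_coset_hom_Mod)

lemma (in normal) r_coset_eq_self_iff: "x \<in> carrier G \<Longrightarrow> H #> x = H \<longleftrightarrow> x \<in> H"
  by (metis coset_join2 rcos_self subgroup_axioms)

text \<open>The criterion is moved in both directions along the projection to
  \<open>G Mod H\<close>. It turns statements about cosets into statements about elements of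
  \<open>G\<close>.\<close>

lemma (in normal) l_coset_in_p_core_iff:
  assumes p: "Factorial_Ring.prime p" and fin: "finite (carrier G)" and x: "x \<in> carrier G"
  shows "x <# H \<in> p_core p (G Mod H) \<longleftrightarrow> p_radical_modulo p G H x"
proof -
  interpret Q: group_hom G "G Mod H" "\<lambda>x. H #> x" by (rule group_hom_r_coset)
  have surj: "(\<lambda>x. H #> x) ` carrier G = carrier (G Mod H)" by (simp add: carrier_FactGroup)
  then have "finite (carrier (G Mod H))" using fin by (metis finite_imageI)
  from Q.H.p_core_iff[OF p this]
  \<comment> \<open>The identity of the quotient is the coset \<open>H\<close>, so having a trivial
    p-power there means having a p-power in \<open>{H}\<close>.\<close>
  have "x <# H \<in> p_core p (G Mod H) \<longleftrightarrow> p_radical_modulo p (G Mod H) {H} (H #> x)"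
    using coset_eq x by (simp add: p_radical_modulo_def)
  also have "\<dots> \<longleftrightarrow> p_radical_modulo p G H x"
    using Q.p_radical_modulo_image[OF _ surj, of p H x "{H}"]
      Q.p_radical_modulo_vimage[of p "{H}" x H, OF _ x] r_coset_eq_self_iff by auto
  finally show ?thesis .
qed

subsection \<open>Sylow conjugacy and lifting of \<open>p\<close>-subgroups\<close>

text \<open>Orbit sizes divide p^n. Without a fixed point none of them is 1, so p divides each and
  hence their sum \<open>card E\<close>.\<close>

lemma (in group_action) p_group_fixed_point:
  assumes p: "Factorial_Ring.prime p" and card: "order G = p ^ n"
    and fin: "finite E" and ndvd: "\<not> p dvd card E"
  shows "\<exists>x\<in>E. \<forall>g\<in>carrier G. (\<phi> g) x = x"
proof (rule ccontr)
  assume no: "\<not> ?thesis"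
  have "p dvd card X" if "X \<in> orbits G E \<phi>" for X
  proof -
    from that obtain x where x: "x \<in> E" "X = orbit G \<phi> x" by (auto simp: orbits_def)
    have "card X \<noteq> 1"
    proof
      assume "card X = 1"
      then have "X = {x}"
        using orbit_refl[OF x(1)] x(2) by (metis card_1_singletonE singletonD)
      then show False
        using no x by (auto simp: orbit_def)
    qed
    moreover have "card X dvd p ^ n"
      using orbit_stabilizer_theorem[OF x(1)] card x(2) by (metis dvd_triv_left)
    ultimately show ?thesis
      using p by (metis divides_primepow_nat dvd_power gr0I power_0)
  qed
  then have "p dvd (\<Sum>X\<in>orbits G E \<phi>. card X)" by (auto intro: dvd_sum)
  then show False using disjoint_sum[OF fin, of "\<lambda>_. 1 :: nat"] ndvd by simp
qed

text \<open>Multiplying by the inverse turns right translation into a left action. The maps are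
  restricted to the cosets because \<open>Bij\<close> asks for extensional functions.\<close>

lemma (in group) r_coset_action:
  assumes "subgroup Q G"
  shows "group_action G (rcosets Q) (\<lambda>g. \<lambda>C\<in>rcosets Q. C #> inv g)"
proof -
  let ?\<phi> = "\<lambda>g. \<lambda>C\<in>rcosets Q. C #> inv g"
  have sub: "C \<subseteq> carrier G" if "C \<in> rcosets Q" for C
    using subgroup.rcosets_carrier[OF assms is_group that] .
  have closed: "C #> g \<in> rcosets Q" if "C \<in> rcosets Q" "g \<in> carrier G" for C g
    using that subgroup.subset[OF assms]
    by (auto simp: RCOSETS_def coset_mult_assoc)
  have "?\<phi> g \<in> Bij (rcosets Q)" if g: "g \<in> carrier G" for g
  proof -
    have "bij_betw (\<lambda>C. C #> inv g) (rcosets Q) (rcosets Q)"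
      using g sub closed
      by (intro bij_betw_byWitness[where f' = "\<lambda>C. C #> g"])
        (auto simp: coset_mult_assoc)
    then show ?thesis
      by (simp add: Bij_def restrict_extensional bij_betw_restrict_eq)
  qed
  moreover have "?\<phi> (g \<otimes> k) = compose (rcosets Q) (?\<phi> g) (?\<phi> k)"
    if "g \<in> carrier G" "k \<in> carrier G" for g k
    using that sub closed by (auto simp: compose_def fun_eq_iff coset_mult_assoc inv_mult_group)
  ultimately have "?\<phi> \<in> hom G (BijGroup (rcosets Q))"
    by (simp add: hom_def BijGroup_def Pi_def)
  then show ?thesis
    by (simp add: group_action_def group_hom_def group_hom_axioms_def is_group group_BijGroup)
qed

text \<open>\<open>P\<close> acts by right translation on the \<open>m\<close> right cosets of
  \<open>Q\<close>. As p does not divide \<open>m\<close>, some coset Qg is fixed, and Qgy = Qg says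
  that g y g^-1 lies in Q.\<close>

lemma (in group) p_subgroup_conjugate_into_sylow:
  assumes p: "Factorial_Ring.prime p" and fin: "finite (carrier G)"
    and Q: "subgroup Q G" "order G = card Q * m" "\<not> p dvd m"
    and P: "p_subgroup p G P"
  shows "\<exists>g\<in>carrier G. \<forall>y\<in>P. g \<otimes> y \<otimes> inv g \<in> Q"
proof -
  interpret Q: subgroup Q G by fact
  have sP: "subgroup P G" using P by (simp add: p_subgroup_def)
  interpret act: group_action "G\<lparr>carrier := P\<rparr>" "rcosets Q" "\<lambda>g. \<lambda>C\<in>rcosets Q. C #> inv g"
    using group_action.induced_action[OF r_coset_action[OF Q(1)] sP] .
  from P obtain n where n: "order (G\<lparr>carrier := P\<rparr>) = p ^ n" by (auto simp: p_subgroup_def order_def)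
  have "card (rcosets Q) * card Q = m * card Q"
    using lagrange[OF Q(1)] Q(2) by (simp only: mult.commute)
  then have "card (rcosets Q) = m"
    using Q.finite_imp_card_positive[OF fin] by simp
  moreover have "finite (rcosets Q)"
    using fin by (simp add: RCOSETS_def)
  ultimately have "\<exists>C\<in>rcosets Q. \<forall>y\<in>P. C #> inv y = C"
    using act.p_group_fixed_point[OF p n] Q(3) by auto
  then obtain C where C: "C \<in> rcosets Q" and fixed: "\<forall>y\<in>P. C #> inv y = C"
    by blast
  from C obtain g where g: "g \<in> carrier G" "C = Q #> g" by (auto simp: RCOSETS_def)
  have "g \<otimes> y \<otimes> inv g \<in> Q" if y: "y \<in> P" for y
  proof -
    have "inv y \<in> P" "y \<in> carrier G" using y sP by (auto simp: subgroup.m_inv_closed subgroup.mem_carrier)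
    then have "C #> y = C" using fixed by (metis inv_inv)
    then have "Q #> (g \<otimes> y) = Q #> g"
      using g \<open>y \<in> carrier G\<close> Q.subset by (simp add: coset_mult_assoc)
    then have "g \<otimes> y \<in> Q #> g"
      using g \<open>y \<in> carrier G\<close> by (metis Q(1) m_closed rcos_self)
    then show ?thesis
      using Q.rcos_module_imp[OF is_group g(1)] by blast
  qed
  with g(1) show ?thesis by blast
qed

text \<open>The normalizer is defined as a stabilizer, so it asks for x Q x^-1 = Q. Conjugation is
  injective and \<open>Q\<close> is finite, so inclusion already gives equality.\<close>

lemma (in group) normalizer_iff:
  assumes fin: "finite (carrier G)" and Q: "Q \<subseteq> carrier G"
  shows "x \<in> normalizer G Q \<longleftrightarrow> x \<in> carrier G \<and> (\<forall>q\<in>Q. x \<otimes> q \<otimes> inv x \<in> Q)"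
proof -
  have "x <# Q #> inv x = Q \<longleftrightarrow> (\<forall>q\<in>Q. x \<otimes> q \<otimes> inv x \<in> Q)" if x: "x \<in> carrier G"
  proof -
    have eq: "x <# Q #> inv x = (\<lambda>q. x \<otimes> q \<otimes> inv x) ` Q"
      by (auto simp: l_coset_def r_coset_def)
    have "inj_on (\<lambda>q. x \<otimes> q \<otimes> inv x) Q"
      using conjugation_is_inj[OF x] Q by (intro inj_onI) blast
    then have "(\<lambda>q. x \<otimes> q \<otimes> inv x) ` Q = Q" if "(\<lambda>q. x \<otimes> q \<otimes> inv x) ` Q \<subseteq> Q"
      using endo_inj_surj[OF finite_subset[OF Q fin] that] by blast
    then show ?thesis
      unfolding eq by blast
  qed
  then show ?thesis
    using Q by (auto simp: normalizer_def stabilizer_def)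
qed

lemma (in group_hom) image_mem_normalizer:
  assumes fin: "finite (carrier G)" "finite (carrier H)"
    and Q: "Q \<subseteq> carrier G" and x: "x \<in> normalizer G Q"
  shows "h x \<in> normalizer H (h ` Q)"
proof -
  have x': "x \<in> carrier G" "\<And>q. q \<in> Q \<Longrightarrow> x \<otimes> q \<otimes> inv x \<in> Q"
    using x by (auto simp: G.normalizer_iff[OF fin(1) Q])
  have "h x \<otimes>\<^bsub>H\<^esub> h q \<otimes>\<^bsub>H\<^esub> inv\<^bsub>H\<^esub> (h x) \<in> h ` Q" if "q \<in> Q" for q
    using that x' Q by (auto intro!: image_eqI[of _ _ "x \<otimes> q \<otimes> inv x"])
  then show ?thesis
    using x' Q by (subst H.normalizer_iff[OF fin(2)]) auto
qed

lemma (in group_hom) p_subgroup_image: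
  assumes "Factorial_Ring.prime p" "finite (carrier G)" "finite (carrier H)" "p_subgroup p G Q"
  shows "p_subgroup p H (h ` Q)"
proof -
  have Q: "subgroup Q G" "\<And>q. q \<in> Q \<Longrightarrow> \<exists>n. q [^] (p ^ n) = \<one>"
    using assms(4) G.p_subgroup_iff[OF assms(1,2)] by auto
  have "\<exists>n. h q [^]\<^bsub>H\<^esub> (p ^ n) = \<one>\<^bsub>H\<^esub>" if "q \<in> Q" for q
    using Q(2)[OF that] subgroup.mem_carrier[OF Q(1) that] by (metis hom_nat_pow hom_one)
  then show ?thesis
    unfolding H.p_subgroup_iff[OF assms(1,3)] using subgroup_img_is_subgroup[OF Q(1)] by blast
qed

section \<open>Lifting p-subgroups and their normalizers along surjections\<close>

lemma (in group_hom) group_hom_restrict: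
  assumes "subgroup I G" "subgroup J H" "h ` I \<subseteq> J"
  shows "group_hom (G\<lparr>carrier := I\<rparr>) (H\<lparr>carrier := J\<rparr>) h"
proof -
  have "h \<in> hom (G\<lparr>carrier := I\<rparr>) (H\<lparr>carrier := J\<rparr>)"
    using assms(3) subgroup.subset[OF assms(1)] by (simp add: hom_def Pi_def subset_iff image_subset_iff)
  then show ?thesis
    by (simp add: group_hom_def group_hom_axioms_def G.subgroup_imp_group H.subgroup_imp_group assms)
qed

text \<open>With K the kernel, |h(Q)| |K \<inter> Q| = p^a and p^c |K| = p^a m, while |K \<inter> Q|
  divides |K|. Writing |h(Q)| = p^b and c = b + d, cancellation shows that p^d divides m, so d = 0
  and Q already fills the image.\<close>

lemma (in group_hom) sylow_image:
  assumes p: "Factorial_Ring.prime p" and fin: "finite (carrier G)"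
    and H: "h ` carrier G = carrier H" "order H = p ^ c"
    and Q: "subgroup Q G" "card Q = p ^ a" "order G = p ^ a * m" "\<not> p dvd m"
  shows "h ` Q = carrier H"
proof -
  let ?K = "kernel G H h"
  have Qc: "Q \<subseteq> carrier G" using Q(1) by (rule subgroup.subset)
  have sub: "h ` Q \<subseteq> carrier H" using Qc by auto
  interpret hQ: group_hom "G\<lparr>carrier := Q\<rparr>" H h
    using group_hom_restrict[OF Q(1) H.subgroup_self sub] by simp
  have finH: "finite (carrier H)" using fin H(1) by (metis finite_imageI)
  have kQ: "kernel (G\<lparr>carrier := Q\<rparr>) H h = ?K \<inter> Q"
    unfolding kernel_def using Qc by fastforce
  have cardQ: "card (h ` Q) * card (?K \<inter> Q) = p ^ a"
    using hQ.card_image_mult_kernel finite_subset[OF Qc fin] unfolding kQ order_def Q(2)[symmetric]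
    by simp
  have cardG: "p ^ c * card ?K = p ^ a * m"
    using card_image_mult_kernel[OF fin] unfolding H(1) H(2)[symmetric] Q(3)[symmetric]
    by (simp only: order_def)
  have order_restrict: "order (G\<lparr>carrier := ?K\<rparr>) = card ?K" by (simp add: order_def)
  have "subgroup (?K \<inter> Q) (G\<lparr>carrier := ?K\<rparr>)"
    using G.subgroup_incl[OF G.subgroups_Inter_pair[OF subgroup_kernel Q(1)] subgroup_kernel] by simp
  then have "card (?K \<inter> Q) dvd card ?K"
    using group.lagrange[OF G.subgroup_imp_group[OF subgroup_kernel]]
    by (metis dvd_triv_right order_restrict)
  then obtain k where k: "card ?K = card (?K \<inter> Q) * k" by blast
  have "card (h ` Q) dvd p ^ a" using cardQ by (metis dvd_triv_left)
  then obtain b where b: "card (h ` Q) = p ^ b" using p divides_primepow_nat by blast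
  have "p ^ b \<le> p ^ c"
    using card_mono[OF finH sub] b H(2) by (simp add: order_def)
  then have "b \<le> c" using p prime_gt_1_nat by auto
  then obtain d where d: "c = b + d" using le_Suc_ex by blast
  have pos: "p ^ b * card (?K \<inter> Q) > 0" using cardQ b p by (metis prime_gt_0_nat zero_less_power)
  have "p ^ b * card (?K \<inter> Q) * (p ^ d * k) = p ^ b * card (?K \<inter> Q) * m"
    using cardG unfolding k d cardQ[unfolded b, symmetric] by (simp only: power_add ac_simps)
  then have "p ^ d * k = m" using pos by auto
  then have "d = 0" using Q(4) by (metis dvd_mult2 dvd_power gr0I)
  then have "card (h ` Q) = card (carrier H)" using b d H(2) by (simp add: order_def)
  then show ?thesis using card_subset_eq[OF finH sub] by simp
qed

text \<open>\<open>Q\<close> is chosen as a Sylow subgroup of the preimage \<open>L\<close> of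
  \<open>P\<close>. Sylow conjugacy inside \<open>L\<close> is what lets the whole normalizer of
  \<open>P\<close> lift as well.\<close>

lemma (in group_hom) p_subgroup_lift:
  assumes p: "Factorial_Ring.prime p" and fin: "finite (carrier G)"
    and surj: "h ` carrier G = carrier H" and P: "p_subgroup p H P"
  obtains Q where "p_subgroup p G Q" "h ` Q = P" "h ` normalizer G Q = normalizer H P"
proof -
  have finH: "finite (carrier H)" using fin surj by (metis finite_imageI)
  have sP: "subgroup P H" using P by (simp add: p_subgroup_def)
  define L where "L = {g \<in> carrier G. h g \<in> P}"
  have sL: "subgroup L G" unfolding L_def by (rule subgroup_vimage[OF sP])
  let ?L = "G\<lparr>carrier := L\<rparr>" and ?P = "H\<lparr>carrier := P\<rparr>"
  interpret L: group ?L by (rule G.subgroup_imp_group[OF sL])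
  interpret hL: group_hom ?L ?P h
    by (rule group_hom_restrict[OF sL sP]) (auto simp: L_def)
  have LG: "L \<subseteq> carrier G" using sL by (rule subgroup.subset)
  have finL: "finite (carrier ?L)" using finite_subset[OF LG fin] by simp
  have hLP: "h ` L = P"
    using subgroup.subset[OF sP] surj by (auto simp: L_def image_iff subset_iff)
  have "order ?L \<noteq> 0" using finL L.order_gt_0_iff_finite by simp
  then obtain a m where m: "order ?L = p ^ a * m" "\<not> p dvd m"
    using p by (metis multiplicity_decompose' not_prime_unit)
  obtain Q where Q: "subgroup Q ?L" "card Q = p ^ a"
    using sylow_thm[OF p L.is_group m(1) finL] by blast
  obtain c where c: "order ?P = p ^ c" using P by (auto simp: p_subgroup_def order_def)
  have hQ: "h ` Q = P"
    using hL.sylow_image[OF p finL _ c Q m] hLP by simp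
  have QG: "subgroup Q G" using G.incl_subgroup[OF sL Q(1)] .
  have QL: "Q \<subseteq> L" using subgroup.subset[OF Q(1)] by simp
  have Qc: "Q \<subseteq> carrier G" using QL LG by blast
  have pQ: "p_subgroup p G Q" using QG Q(2) by (auto simp: p_subgroup_def)
  have "y \<in> h ` normalizer G Q" if y: "y \<in> normalizer H P" for y
  proof -
    have y': "y \<in> carrier H" "\<And>q. q \<in> P \<Longrightarrow> y \<otimes>\<^bsub>H\<^esub> q \<otimes>\<^bsub>H\<^esub> inv\<^bsub>H\<^esub> y \<in> P"
      using y H.normalizer_iff[OF finH subgroup.subset[OF sP]] by auto
    then obtain x where x: "x \<in> carrier G" "y = h x" using surj by blast
    \<comment> \<open>Frattini argument: the conjugate \<open>?R\<close> of \<open>Q\<close> lies in \<open>L\<close> again, hence is conjugate to \<open>Q\<close> by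
      some \<open>g \<in> L\<close>, and \<open>h g\<close> can be corrected by an element of \<open>Q\<close>.\<close>
    let ?R = "(\<lambda>q. x \<otimes> q \<otimes> inv x) ` Q"
    have "?R \<subseteq> L"
      using x y' Qc hQ by (auto simp: L_def)
    \<comment> \<open>Conjugation is an endomorphism, so the conjugate \<open>?R\<close> is a
      p-subgroup by the lemma on images.\<close>
    have "group_hom G G (\<lambda>q. x \<otimes> q \<otimes> inv x)"
      using x(1) by unfold_locales (auto simp: hom_def G.m_assoc G.inv_solve_left)
    then have "p_subgroup p G ?R"
      by (rule group_hom.p_subgroup_image[OF _ p fin fin pQ])
    then have "p_subgroup p ?L ?R"
      using G.subgroup_incl[OF _ sL \<open>?R \<subseteq> L\<close>] by (simp add: p_subgroup_def)
    from L.p_subgroup_conjugate_into_sylow[OF p finL Q(1) _ m(2) this] m(1) Q(2)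
    obtain g where g: "g \<in> L" and conj: "\<forall>q\<in>Q. g \<otimes> (x \<otimes> q \<otimes> inv x) \<otimes> inv\<^bsub>?L\<^esub> g \<in> Q"
      by auto
    have gc: "g \<in> carrier G" using g LG by blast
    have "h g \<in> h ` Q" using g by (simp add: L_def hQ)
    then obtain q where q: "q \<in> Q" "h g = h q" by blast
    have qc: "q \<in> carrier G" using q(1) Qc by blast
    have "g \<otimes> x \<otimes> r \<otimes> inv (g \<otimes> x) \<in> Q" if "r \<in> Q" for r
    proof -
      have "g \<otimes> x \<otimes> r \<otimes> inv (g \<otimes> x) = g \<otimes> (x \<otimes> r \<otimes> inv x) \<otimes> inv\<^bsub>?L\<^esub> g"
        using that gc x(1) Qc g sL by (simp add: G.m_assoc G.inv_mult_group subset_iff)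
      then show ?thesis using conj that by simp
    qed
    then have gx: "g \<otimes> x \<in> normalizer G Q"
      using gc x(1) by (simp add: G.normalizer_iff[OF fin Qc])
    have "inv q \<in> normalizer G Q"
      using q(1) qc QG Qc by (auto simp: G.normalizer_iff[OF fin Qc] subgroup.m_closed subgroup.m_inv_closed)
    then have "inv q \<otimes> (g \<otimes> x) \<in> normalizer G Q"
      using gx G.normalizer_imp_subgroup[OF Qc] by (simp add: subgroup.m_closed)
    moreover have "h (inv q \<otimes> (g \<otimes> x)) = y"
      using qc gc x q(2) by (simp add: H.m_assoc[symmetric])
    ultimately show ?thesis by blast
  qed
  moreover have "h ` normalizer G Q \<subseteq> normalizer H P"
    using image_mem_normalizer[OF fin finH Qc] hQ by blast
  ultimately show thesis using that pQ hQ by blast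
qed

subsection \<open>Commutators, normalizers and centralizers\<close>

lemma (in group) commutator_subgroup_subset_iff:
  assumes "subgroup S G"
  shows "commutator_subgroup G Q x \<subseteq> S \<longleftrightarrow> (\<forall>q\<in>Q. inv q \<otimes> inv x \<otimes> q \<otimes> x \<in> S)"
proof -
  let ?C = "{inv q \<otimes> inv x \<otimes> q \<otimes> x | q. q \<in> Q}"
  have "generate G ?C \<subseteq> S \<longleftrightarrow> ?C \<subseteq> S"
    using generate_subgroup_incl[OF _ assms] generate.incl[of _ ?C G] by blast
  then show ?thesis
    unfolding commutator_subgroup_def by blast
qed

lemma (in group) commutator_subgroup_is_subgroup:
  assumes "Q \<subseteq> carrier G" "x \<in> carrier G"
  shows "subgroup (commutator_subgroup G Q x) G"
  unfolding commutator_subgroup_def using assms by (intro generate_is_subgroup) auto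

lemma (in group) commutator_subgroup_in_carrier:
  assumes "Q \<subseteq> carrier G" "x \<in> carrier G"
  shows "commutator_subgroup G Q x \<subseteq> carrier G"
  using subgroup.subset[OF commutator_subgroup_is_subgroup[OF assms]] .

lemma (in group_hom) commutator_subgroup_image:
  assumes "Q \<subseteq> carrier G" "x \<in> carrier G"
  shows "commutator_subgroup H (h ` Q) (h x) = h ` commutator_subgroup G Q x"
proof -
  let ?C = "{inv q \<otimes> inv x \<otimes> q \<otimes> x | q. q \<in> Q}"
  have "?C \<subseteq> carrier G" using assms by auto
  moreover have "h (inv q \<otimes> inv x \<otimes> q \<otimes> x) = inv\<^bsub>H\<^esub> (h q) \<otimes>\<^bsub>H\<^esub> inv\<^bsub>H\<^esub> (h x) \<otimes>\<^bsub>H\<^esub> h q \<otimes>\<^bsub>H\<^esub> h x"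
    if "q \<in> Q" for q
    using that assms by (simp add: subset_iff)
  then have "{inv\<^bsub>H\<^esub> q \<otimes>\<^bsub>H\<^esub> inv\<^bsub>H\<^esub> (h x) \<otimes>\<^bsub>H\<^esub> q \<otimes>\<^bsub>H\<^esub> h x | q. q \<in> h ` Q} = h ` ?C"
    unfolding Setcompr_eq_image image_image by (intro image_cong) auto
  ultimately show ?thesis
    unfolding commutator_subgroup_def by (simp only: generate_img)
qed

lemma (in group_hom) iterated_commutator_subgroup_image_trivial_iff:
  assumes "Q \<subseteq> carrier G" "x \<in> carrier G"
  shows "commutator_subgroup H (commutator_subgroup H (h ` Q) (h x)) (h x) = {\<one>\<^bsub>H\<^esub>} \<longleftrightarrow>
    commutator_subgroup G (commutator_subgroup G Q x) x \<subseteq> kernel G H h"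
proof -
  let ?W = "commutator_subgroup G (commutator_subgroup G Q x) x"
  have c: "commutator_subgroup G Q x \<subseteq> carrier G"
    by (rule G.commutator_subgroup_in_carrier[OF assms])
  interpret W: subgroup ?W G
    by (rule G.commutator_subgroup_is_subgroup[OF c assms(2)])
  \<comment> \<open>Equality with the trivial group exceeds mere inclusion by containing the
    identity, which the subgroup \<open>?W\<close> supplies.\<close>
  have "\<one>\<^bsub>H\<^esub> \<in> h ` ?W" using W.one_closed hom_one by (metis imageI)
  then have "h ` ?W = {\<one>\<^bsub>H\<^esub>} \<longleftrightarrow> ?W \<subseteq> kernel G H h"
    using W.subset unfolding kernel_def by auto
  then show ?thesis
    using assms c by (simp add: commutator_subgroup_image)
qed

text \<open>The commutator of q and x is (x q)^-1 (q x), so it lies in the kernel exactly when the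
  images of q and x commute.\<close>

lemma (in group_hom) image_mem_centralizer_iff:
  assumes "Q \<subseteq> carrier G" "x \<in> carrier G"
  shows "h x \<in> centralizer H (h ` Q) \<longleftrightarrow> commutator_subgroup G Q x \<subseteq> kernel G H h"
proof -
  have "inv q \<otimes> inv x \<otimes> q \<otimes> x \<in> kernel G H h \<longleftrightarrow> h x \<otimes>\<^bsub>H\<^esub> h q = h q \<otimes>\<^bsub>H\<^esub> h x"
    if "q \<in> Q" for q
  proof -
    have q: "q \<in> carrier G" using that assms by blast
    have "inv q \<otimes> inv x \<otimes> q \<otimes> x = inv (x \<otimes> q) \<otimes> (q \<otimes> x)"
      using q assms(2) by (simp add: G.inv_mult_group G.m_assoc)
    then have "inv q \<otimes> inv x \<otimes> q \<otimes> x \<in> kernel G H h \<longleftrightarrow>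
        inv\<^bsub>H\<^esub> (h (x \<otimes> q)) \<otimes>\<^bsub>H\<^esub> h (q \<otimes> x) = \<one>\<^bsub>H\<^esub>"
      using q assms(2) by (simp add: kernel_def)
    also have "\<dots> \<longleftrightarrow> h (x \<otimes> q) = h (q \<otimes> x)"
      using q assms(2) by (metis G.m_closed H.inv_closed H.inv_equality H.inv_inv H.l_inv hom_closed)
    finally show ?thesis using q assms(2) by simp
  qed
  then show ?thesis
    unfolding G.commutator_subgroup_subset_iff[OF subgroup_kernel]
    using assms(2) by (auto simp: centralizer_def)
qed

section \<open>Commutators and normalizers computed inside a subgroup\<close>

lemma (in group) group_hom_inclusion:
  assumes "subgroup I G" "subgroup J G" "I \<subseteq> J"
  shows "group_hom (G\<lparr>carrier := I\<rparr>) (G\<lparr>carrier := J\<rparr>) id"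
proof -
  interpret group_hom G G id
    by (simp add: group_hom_def group_hom_axioms_def is_group hom_def)
  show ?thesis using group_hom_restrict[OF assms(1,2)] assms(3) by simp
qed

text \<open>This is the lemma on images, applied to the inclusion of \<open>A\<close>, for which
  \<open>h\<close> is the identity.\<close>

lemma (in group) commutator_subgroup_restrict:
  assumes "subgroup A G" "Q \<subseteq> A" "x \<in> A"
  shows "commutator_subgroup (G\<lparr>carrier := A\<rparr>) Q x = commutator_subgroup G Q x"
  using group_hom.commutator_subgroup_image[OF
      group_hom_inclusion[OF assms(1) subgroup_self subgroup.subset[OF assms(1)]], of Q x] assms(2,3)
  by simp

lemma (in group) iterated_commutator_subgroup_restrict:
  assumes "subgroup A G" "Q \<subseteq> A" "x \<in> A"
  shows "commutator_subgroup (G\<lparr>carrier := A\<rparr>) (commutator_subgroup (G\<lparr>carrier := A\<rparr>) Q x) x =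
    commutator_subgroup G (commutator_subgroup G Q x) x"
proof -
  interpret A: group "G\<lparr>carrier := A\<rparr>" by (rule subgroup_imp_group[OF assms(1)])
  have "commutator_subgroup (G\<lparr>carrier := A\<rparr>) Q x \<subseteq> A"
    using A.commutator_subgroup_in_carrier[of Q x] assms by simp
  then show ?thesis
    using assms by (simp add: commutator_subgroup_restrict)
qed

lemma (in group) normalizer_restrict:
  assumes fin: "finite (carrier G)" and A: "subgroup A G" and Q: "Q \<subseteq> A"
  shows "normalizer (G\<lparr>carrier := A\<rparr>) Q = normalizer G Q \<inter> A"
proof -
  interpret A: group "G\<lparr>carrier := A\<rparr>" by (rule subgroup_imp_group[OF A])
  have AG: "A \<subseteq> carrier G" using A by (rule subgroup.subset)
  have "finite (carrier (G\<lparr>carrier := A\<rparr>))" using finite_subset[OF AG fin] by simp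
  note A.normalizer_iff[OF this, of Q]
  moreover have "Q \<subseteq> carrier G" using Q AG by blast
  note normalizer_iff[OF fin this]
  ultimately show ?thesis
    using Q AG by (auto simp: m_inv_consistent[OF A])
qed

text \<open>Each generator is q^-1 times x^-1 q x, and the inverse of x also normalizes
  \<open>Q\<close>.\<close>

lemma (in group) commutator_subgroup_subset_normalized:
  assumes fin: "finite (carrier G)" and Q: "subgroup Q G" and x: "x \<in> normalizer G Q"
  shows "commutator_subgroup G Q x \<subseteq> Q"
proof -
  interpret Q: subgroup Q G by fact
  have xc: "x \<in> carrier G" and ix: "inv x \<in> normalizer G Q"
    using x normalizer_imp_subgroup[OF Q.subset]
    by (auto simp: subgroup.m_inv_closed subgroup.mem_carrier)
  have "inv q \<otimes> inv x \<otimes> q \<otimes> x \<in> Q" if q: "q \<in> Q" for q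
  proof -
    have "inv x \<otimes> q \<otimes> inv (inv x) \<in> Q"
      using ix q normalizer_iff[OF fin Q.subset] by blast
    then have "inv q \<otimes> (inv x \<otimes> q \<otimes> inv (inv x)) \<in> Q" using q by simp
    then show ?thesis using q xc by (simp add: m_assoc)
  qed
  then show ?thesis using commutator_subgroup_subset_iff[OF Q] by blast
qed

text \<open>The centralizer consists of the elements whose conjugation fixes \<open>Q\<close>
  pointwise. Normality makes the quotient in the definition of p-stability a group, as the coset
  criterion for the p-core requires.\<close>

lemma (in group) centralizer_normal:
  assumes fin: "finite (carrier G)" and Q: "subgroup Q G"
  shows "centralizer G Q \<lhd> G\<lparr>carrier := normalizer G Q\<rparr>"
proof -
  interpret Q: subgroup Q G by fact
  have sN: "subgroup (normalizer G Q) G" by (rule normalizer_imp_subgroup[OF Q.subset])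
  interpret N: group "G\<lparr>carrier := normalizer G Q\<rparr>" by (rule subgroup_imp_group[OF sN])
  have iff: "x \<in> centralizer G Q \<longleftrightarrow> x \<in> carrier G \<and> (\<forall>q\<in>Q. x \<otimes> q \<otimes> inv x = q)" for x
    by (auto simp: centralizer_def inv_solve_right')
  have sub: "centralizer G Q \<subseteq> normalizer G Q"
    unfolding subset_iff normalizer_iff[OF fin Q.subset] iff by simp
  have "subgroup (centralizer G Q) G"
  proof (rule subgroupI)
    show "centralizer G Q \<subseteq> carrier G" by (auto simp: centralizer_def)
    show "centralizer G Q \<noteq> {}" by (auto simp: centralizer_def intro!: exI[of _ \<one>])
  next
    fix x assume x: "x \<in> centralizer G Q"
    then have "inv x \<otimes> q = q \<otimes> inv x" if "q \<in> Q" for q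
      using that by (simp add: centralizer_def inv_solve_left' m_assoc[symmetric]) (simp add: m_assoc)
    with x show "inv x \<in> centralizer G Q" by (simp add: centralizer_def)
  next
    fix x y assume xy: "x \<in> centralizer G Q" "y \<in> centralizer G Q"
    then have "x \<otimes> y \<otimes> q = q \<otimes> (x \<otimes> y)" if "q \<in> Q" for q
      using that by (simp add: centralizer_def m_assoc) (simp add: m_assoc[symmetric])
    with xy show "x \<otimes> y \<in> centralizer G Q" by (simp add: centralizer_def)
  qed
  then have "subgroup (centralizer G Q) (G\<lparr>carrier := normalizer G Q\<rparr>)"
    using subgroup_incl[OF _ sN sub] by blast
  moreover have "g \<otimes> c \<otimes> inv g \<in> centralizer G Q"
    if g: "g \<in> normalizer G Q" and c: "c \<in> centralizer G Q" for g c
  proof -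
    have gc: "g \<in> carrier G" "c \<in> carrier G" "inv g \<in> normalizer G Q"
      using g c sN by (auto simp: subgroup.m_inv_closed subgroup.mem_carrier centralizer_def)
    have "g \<otimes> c \<otimes> inv g \<otimes> q \<otimes> inv (g \<otimes> c \<otimes> inv g) = q" if q: "q \<in> Q" for q
    proof -
      have r: "inv g \<otimes> q \<otimes> g \<in> Q"
        using gc q normalizer_iff[OF fin Q.subset, of "inv g"] by auto
      \<comment> \<open>The conjugate of c by g acts on q by moving it back to g^-1 q g, which is
        again in \<open>Q\<close>, applying c there, and returning.\<close>
      have "g \<otimes> c \<otimes> inv g \<otimes> q \<otimes> inv (g \<otimes> c \<otimes> inv g) = g \<otimes> (c \<otimes> (inv g \<otimes> q \<otimes> g) \<otimes> inv c) \<otimes> inv g"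
        using gc q by (simp add: inv_mult_group m_assoc)
      also have "\<dots> = g \<otimes> (inv g \<otimes> q \<otimes> g) \<otimes> inv g"
        using c r by (simp add: iff)
      also have "\<dots> = q"
        using conjugation_is_surj[OF gc(1) Q.mem_carrier[OF q]] .
      finally show ?thesis .
    qed
    then show ?thesis unfolding iff using gc by simp
  qed
  ultimately show ?thesis
    unfolding N.normal_inv_iff by (simp add: m_inv_consistent[OF sN])
qed

text \<open>The coset in the p-core of the quotient is replaced by the elementwise criterion, which
  can be moved along homomorphisms.\<close>

lemma (in group) p_stable_iff:
  assumes p: "Factorial_Ring.prime p" and fin: "finite (carrier G)"
  shows "p_stable p G \<longleftrightarrow> (\<forall>Q x. p_subgroup p G Q \<longrightarrow> x \<in> normalizer G Q \<longrightarrow>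
    commutator_subgroup G (commutator_subgroup G Q x) x = {\<one>} \<longrightarrow>
    p_radical_modulo p (G\<lparr>carrier := normalizer G Q\<rparr>) (centralizer G Q) x)"
proof -
  have "x <# centralizer G Q \<in> p_core p (G\<lparr>carrier := normalizer G Q\<rparr> Mod centralizer G Q) \<longleftrightarrow>
      p_radical_modulo p (G\<lparr>carrier := normalizer G Q\<rparr>) (centralizer G Q) x"
    if "p_subgroup p G Q" and x: "x \<in> normalizer G Q" for Q x
  proof -
    have Q: "subgroup Q G" using that(1) by (simp add: p_subgroup_def)
    have "finite (normalizer G Q)"
      using subgroup.subset[OF normalizer_imp_subgroup[OF subgroup.subset[OF Q]]] fin
      by (rule finite_subset)
    then show ?thesis
      using normal.l_coset_in_p_core_iff[OF centralizer_normal[OF fin Q] p, of x] x by simp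
  qed
  then show ?thesis unfolding p_stable_def by blast
qed

subsection \<open>Stability of sections\<close>

text \<open>Since \<open>R\<close> is normal in \<open>Q\<close>, the group \<open>Q\<close> lies in
  the normalizer of \<open>R\<close>. Thus Q/R is the image of \<open>Q\<close> under the projection
  \<open>h\<close> from \<open>N\<close> to \<open>N Mod R\<close>.\<close>

locale normal_section = group +
  fixes Q R
  assumes fin: "finite (carrier G)" and Q: "subgroup Q G" and R: "R \<lhd> G\<lparr>carrier := Q\<rparr>"
begin

abbreviation "N \<equiv> G\<lparr>carrier := normalizer G R\<rparr>"
abbreviation "D \<equiv> section_normalizer G Q R"
abbreviation "h \<equiv> (\<lambda>x. R #> x)"

lemma R_subgroup: "subgroup R G"
  using incl_subgroup[OF Q normal_imp_subgroup[OF R]] .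

lemma normalizer_subgroup: "subgroup (normalizer G R) G"
  by (rule normalizer_imp_subgroup[OF subgroup.subset[OF R_subgroup]])

lemma R_normal: "R \<lhd> N"
  by (rule subgroup_in_normalizer[OF R_subgroup])

lemma finite_N: "finite (carrier N)"
  using finite_subset[OF subgroup.subset[OF normalizer_subgroup] fin] by simp

lemma Q_subset: "Q \<subseteq> normalizer G R"
  using subgroup.subset[OF normal_imp_subgroup_normalizer[OF Q R]] by simp

lemma D_subgroup: "subgroup D G"
  unfolding section_normalizer_def
  by (intro subgroups_Inter_pair normalizer_subgroup normalizer_imp_subgroup subgroup.subset[OF Q])

lemma D_subset: "D \<subseteq> normalizer G R" "D \<subseteq> normalizer G Q"
  by (simp_all add: section_normalizer_def)

lemma quotient_hom: "group_hom N (N Mod R) h"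
  using normal.group_hom_r_coset[OF R_normal] by simp

lemma finite_quotient: "finite (carrier (N Mod R))"
  using finite_N by (simp add: carrier_FactGroup)

lemma kernel_quotient: "kernel N (N Mod R) h = R"
  using normal.r_coset_eq_self_iff[OF R_normal] subgroup.subset[OF normal_imp_subgroup[OF R_normal]]
  by (auto simp: kernel_def)

text \<open>\<open>D\<close> is the normalizer of \<open>Q\<close> inside \<open>N\<close>, so the
  projection carries it into the normalizer of Q/R. Stability is pulled back along this map.\<close>

lemma normalizer_quotient_hom:
  "group_hom (G\<lparr>carrier := D\<rparr>) ((N Mod R)\<lparr>carrier := normalizer (N Mod R) (h ` Q)\<rparr>) h"
proof -
  interpret h: group_hom N "N Mod R" h by (rule quotient_hom)
  have "h ` Q \<subseteq> carrier (N Mod R)"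
    using Q_subset by (auto simp: carrier_FactGroup)
  then have "subgroup (normalizer (N Mod R) (h ` Q)) (N Mod R)"
    by (rule h.H.normalizer_imp_subgroup)
  moreover have "D \<subseteq> normalizer N Q"
    using normalizer_restrict[OF fin normalizer_subgroup Q_subset] by (simp add: section_normalizer_def)
  then have "h ` D \<subseteq> normalizer (N Mod R) (h ` Q)"
    using h.image_mem_normalizer[OF finite_N finite_quotient] Q_subset by auto
  moreover have "subgroup D N"
    by (rule subgroup_incl[OF D_subgroup normalizer_subgroup D_subset(1)])
  ultimately show ?thesis
    using h.group_hom_restrict by fastforce
qed

text \<open>The kernel of \<open>h\<close> is \<open>R\<close>, so [Q, x] \<subseteq> R says exactly
  that the coset of \<open>x\<close> commutes with Q/R.\<close>

lemma mem_section_centralizer_iff: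
  assumes "x \<in> D"
  shows "x \<in> section_centralizer G Q R \<longleftrightarrow> h x \<in> centralizer (N Mod R) (h ` Q)"
proof -
  interpret h: group_hom N "N Mod R" h by (rule quotient_hom)
  have x: "x \<in> normalizer G R" using assms D_subset by blast
  have "h x \<in> centralizer (N Mod R) (h ` Q) \<longleftrightarrow> commutator_subgroup N Q x \<subseteq> R"
    using h.image_mem_centralizer_iff[of Q x] x Q_subset kernel_quotient by simp
  then show ?thesis
    using assms commutator_subgroup_restrict[OF normalizer_subgroup Q_subset x]
    by (simp add: section_centralizer_def)
qed

lemma iterated_commutator_quotient_iff:
  assumes "x \<in> D"
  shows "commutator_subgroup (N Mod R) (commutator_subgroup (N Mod R) (h ` Q) (h x)) (h x) = {\<one>\<^bsub>N Mod R\<^esub>}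
    \<longleftrightarrow> commutator_subgroup G (commutator_subgroup G Q x) x \<subseteq> R"
proof -
  interpret h: group_hom N "N Mod R" h by (rule quotient_hom)
  have x: "x \<in> normalizer G R" using assms D_subset by blast
  show ?thesis
    using h.iterated_commutator_subgroup_image_trivial_iff[of Q x] x Q_subset kernel_quotient
      iterated_commutator_subgroup_restrict[OF normalizer_subgroup Q_subset x] by simp
qed

text \<open>It is the preimage in \<open>D\<close> of the centralizer of Q/R, which is normal in the
  normalizer of Q/R.\<close>

lemma section_centralizer_normal: "section_centralizer G Q R \<lhd> G\<lparr>carrier := D\<rparr>"
proof -
  interpret h: group_hom N "N Mod R" h by (rule quotient_hom)
  have "subgroup Q N" by (rule subgroup_incl[OF Q normalizer_subgroup Q_subset])
  then have "subgroup (h ` Q) (N Mod R)" by (rule h.subgroup_img_is_subgroup)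
  from group_hom.normal_vimage[OF normalizer_quotient_hom h.H.centralizer_normal[OF finite_quotient this]]
  have "{d \<in> D. h d \<in> centralizer (N Mod R) (h ` Q)} \<lhd> G\<lparr>carrier := D\<rparr>" by simp
  moreover have "{d \<in> D. h d \<in> centralizer (N Mod R) (h ` Q)} = section_centralizer G Q R"
    using mem_section_centralizer_iff by (auto simp: section_centralizer_def)
  ultimately show ?thesis by simp
qed

end

section \<open>The implications between the stability conditions\<close>

lemma (in group) section_p_stable_iff:
  assumes p: "Factorial_Ring.prime p" and fin: "finite (carrier G)"
  shows "section_p_stable p G \<longleftrightarrow>
    (\<forall>Q R x. p_subgroup p G Q \<longrightarrow> p_subgroup p G R \<longrightarrow> R \<lhd> G\<lparr>carrier := Q\<rparr> \<longrightarrow>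
      x \<in> section_normalizer G Q R \<longrightarrow>
      commutator_subgroup G (commutator_subgroup G Q x) x \<subseteq> R \<longrightarrow>
      p_radical_modulo p (G\<lparr>carrier := section_normalizer G Q R\<rparr>) (section_centralizer G Q R) x)"
proof -
  have "x <# section_centralizer G Q R
        \<in> p_core p (G\<lparr>carrier := section_normalizer G Q R\<rparr> Mod section_centralizer G Q R) \<longleftrightarrow>
      p_radical_modulo p (G\<lparr>carrier := section_normalizer G Q R\<rparr>) (section_centralizer G Q R) x"
    if "p_subgroup p G Q" "R \<lhd> G\<lparr>carrier := Q\<rparr>" and x: "x \<in> section_normalizer G Q R" for Q R x
  proof -
    interpret normal_section G Q R
      using that fin
      by (intro normal_section.intro normal_section_axioms.intro is_group)
        (simp_all add: p_subgroup_def)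
    have "finite (section_normalizer G Q R)"
      using subgroup.subset[OF D_subgroup] fin by (rule finite_subset)
    then show ?thesis
      using normal.l_coset_in_p_core_iff[OF section_centralizer_normal p, of x] x by simp
  qed
  then show ?thesis unfolding section_p_stable_def by blast
qed

text \<open>Stability of \<open>N Mod R\<close> is used for the p-subgroup Q/R and the coset of
  \<open>x\<close>. The result is pulled back to \<open>D\<close>, where the preimage of the
  centralizer of Q/R is the section centralizer.\<close>

lemma (in group) section_p_stable_if_normalizer_quotients:
  assumes p: "Factorial_Ring.prime p" and fin: "finite (carrier G)"
    and stable: "\<And>R. p_subgroup p G R \<Longrightarrow> p_stable p (G\<lparr>carrier := normalizer G R\<rparr> Mod R)"
  shows "section_p_stable p G"
  unfolding section_p_stable_iff[OF p fin]
proof (intro allI impI)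
  fix Q R x
  assume pQ: "p_subgroup p G Q" and pR: "p_subgroup p G R" "R \<lhd> G\<lparr>carrier := Q\<rparr>"
    and x: "x \<in> section_normalizer G Q R"
    and comm: "commutator_subgroup G (commutator_subgroup G Q x) x \<subseteq> R"
  interpret normal_section G Q R
    using pQ pR fin
    by (intro normal_section.intro normal_section_axioms.intro is_group)
      (simp_all add: p_subgroup_def)
  interpret h: group_hom N "N Mod R" h by (rule quotient_hom)
  interpret hD: group_hom "G\<lparr>carrier := D\<rparr>"
    "(N Mod R)\<lparr>carrier := normalizer (N Mod R) (h ` Q)\<rparr>" h
    by (rule normalizer_quotient_hom)
  have "p_subgroup p N Q"
    using pQ subgroup_incl[OF _ normalizer_subgroup Q_subset] by (simp add: p_subgroup_def)
  then have "p_subgroup p (N Mod R) (h ` Q)"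
    by (rule h.p_subgroup_image[OF p finite_N finite_quotient])
  moreover have "h x \<in> normalizer (N Mod R) (h ` Q)"
    using hD.hom_closed[of x] x by simp
  moreover have "commutator_subgroup (N Mod R) (commutator_subgroup (N Mod R) (h ` Q) (h x)) (h x)
      = {\<one>\<^bsub>N Mod R\<^esub>}"
    using iterated_commutator_quotient_iff[OF x] comm by blast
  ultimately have "p_radical_modulo p ((N Mod R)\<lparr>carrier := normalizer (N Mod R) (h ` Q)\<rparr>)
      (centralizer (N Mod R) (h ` Q)) (h x)"
    using stable[OF pR(1)] unfolding h.H.p_stable_iff[OF p finite_quotient] by blast
  then show "p_radical_modulo p (G\<lparr>carrier := D\<rparr>) (section_centralizer G Q R) x"
    using hD.p_radical_modulo_vimage mem_section_centralizer_iff x by simp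
qed

lemma (in group) p_stable_section_if_section_p_stable:
  assumes p: "Factorial_Ring.prime p" and fin: "finite (carrier G)"
    and stable: "section_p_stable p G"
    and H: "subgroup H G" and K: "K \<lhd> G\<lparr>carrier := H\<rparr>"
  shows "p_stable p (G\<lparr>carrier := H\<rparr> Mod K)"
proof -
  let ?A = "G\<lparr>carrier := H\<rparr>" and ?h = "\<lambda>x. K #> x"
  let ?B = "?A Mod K"
  interpret A: group ?A by (rule subgroup_imp_group[OF H])
  interpret K: normal K ?A by (rule K)
  interpret h: group_hom ?A ?B ?h using K.group_hom_r_coset by simp
  have HG: "H \<subseteq> carrier G" using H by (rule subgroup.subset)
  have finA: "finite (carrier ?A)" using finite_subset[OF HG fin] by simp
  have surj: "?h ` carrier ?A = carrier ?B" by (simp add: carrier_FactGroup)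
  then have finB: "finite (carrier ?B)" using finA by (metis finite_imageI)
  have ker: "kernel ?A ?B ?h = K"
    using K.r_coset_eq_self_iff K.subset by (auto simp: kernel_def)
  have KG: "subgroup K G" using incl_subgroup[OF H K.subgroup_axioms] .
  show ?thesis
    unfolding h.H.p_stable_iff[OF p finB]
  proof (intro allI impI)
    fix P X
    assume P: "p_subgroup p ?B P" and X: "X \<in> normalizer ?B P"
      and comm: "commutator_subgroup ?B (commutator_subgroup ?B P X) X = {\<one>\<^bsub>?B\<^esub>}"
    obtain Q where pQ: "p_subgroup p ?A Q" and hQ: "?h ` Q = P"
      and norm: "?h ` normalizer ?A Q = normalizer ?B P"
      using h.p_subgroup_lift[OF p finA surj P] by blast
    from X norm obtain x where x: "x \<in> normalizer ?A Q" "X = K #> x" by blast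
    have QA: "subgroup Q ?A" using pQ by (simp add: p_subgroup_def)
    have QH: "Q \<subseteq> H" using subgroup.subset[OF QA] by simp
    have QG: "subgroup Q G" using incl_subgroup[OF H QA] .
    have pQG: "p_subgroup p G Q" using pQ QG by (simp add: p_subgroup_def)
    \<comment> \<open>This is the kernel of the map from \<open>Q\<close> onto \<open>P\<close>, so
      Q/R is a copy of \<open>P\<close> inside a section by p-subgroups of \<open>G\<close>.\<close>
    let ?R = "Q \<inter> K"
    have RG: "subgroup ?R G" using subgroups_Inter_pair[OF QG KG] .
    have pR: "p_subgroup p G ?R"
      using pQG RG unfolding p_subgroup_iff[OF p fin] by blast
    have RQ: "?R \<lhd> G\<lparr>carrier := Q\<rparr>"
      using normal_inter[OF H QG K] QH by (simp add: Int_commute inf.absorb2)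
    have D: "subgroup (normalizer ?A Q) ?A"
      using A.normalizer_imp_subgroup QH by simp
    let ?D = "normalizer ?A Q"
    have DH: "?D \<subseteq> H" using subgroup.subset[OF D] by simp
    have DG: "subgroup ?D G" using incl_subgroup[OF H D] .
    have DQ: "?D \<subseteq> normalizer G Q"
      using normalizer_restrict[OF fin H QH] by blast
    \<comment> \<open>An element of \<open>?D\<close> normalizes \<open>Q\<close> by definition and
      \<open>K\<close> because it lies in \<open>H\<close>, so it normalizes the
      intersection.\<close>
    have "d \<otimes> r \<otimes> inv d \<in> ?R" if d: "d \<in> ?D" and r: "r \<in> ?R" for d r
    proof -
      have "d \<otimes> r \<otimes> inv d \<in> Q"
        using d r DQ normalizer_iff[OF fin subgroup.subset[OF QG]] by blast
      moreover have "d \<otimes> r \<otimes> inv d \<in> K"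
        using K.inv_op_closed2[of d r] d r DH m_inv_consistent[OF H] by auto
      ultimately show ?thesis by blast
    qed
    then have DR: "?D \<subseteq> normalizer G ?R"
      using DH HG normalizer_iff[OF fin subgroup.subset[OF RG]] by blast
    interpret normal_section G Q ?R
      using QG RQ fin by (intro normal_section.intro normal_section_axioms.intro is_group)
    have DD: "?D \<subseteq> D" using DQ DR by (simp add: section_normalizer_def)
    have xH: "x \<in> H" using x(1) DH by blast
    \<comment> \<open>The hypothesis on \<open>P\<close> and \<open>X\<close> only bounds the double
      commutator by \<open>K\<close>; the bound by \<open>Q\<close> comes from \<open>x\<close>
      normalizing \<open>Q\<close>.\<close>
    have "commutator_subgroup G (commutator_subgroup G Q x) x \<subseteq> K"
      using h.iterated_commutator_subgroup_image_trivial_iff[of Q x] QH xH comm ker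
        iterated_commutator_subgroup_restrict[OF H QH xH] by (simp add: hQ x(2))
    moreover have "commutator_subgroup G (commutator_subgroup G Q x) x \<subseteq> Q"
    proof -
      have xQ: "x \<in> normalizer G Q" using x(1) DQ by blast
      have "commutator_subgroup G Q x \<subseteq> Q"
        by (rule commutator_subgroup_subset_normalized[OF fin QG xQ])
      \<comment> \<open>As [Q, x] \<subseteq> Q, the generators of the second commutator subgroup
        are themselves commutators of elements of \<open>Q\<close> with x.\<close>
      then show ?thesis
        using commutator_subgroup_subset_iff[OF QG, of Q x]
          commutator_subgroup_subset_iff[OF QG, of "commutator_subgroup G Q x" x] by blast
    qed
    ultimately have comm_R: "commutator_subgroup G (commutator_subgroup G Q x) x \<subseteq> ?R" by blast
    have "p_radical_modulo p (G\<lparr>carrier := D\<rparr>) (section_centralizer G Q ?R) x"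
      using stable pQG pR RQ comm_R x(1) DD
      unfolding section_p_stable_iff[OF p fin] by blast
    \<comment> \<open>Section stability speaks of \<open>D\<close>, which need not lie in
      \<open>H\<close>. Restricting to \<open>?D\<close> makes the projection to \<open>?B\<close>
      available and keeps the image equal to the normalizer of \<open>P\<close>.\<close>
    then have rad: "p_radical_modulo p (G\<lparr>carrier := ?D\<rparr>) (section_centralizer G Q ?R) x"
      using group_hom.p_radical_modulo_vimage[OF group_hom_inclusion[OF DG D_subgroup DD],
          of p "section_centralizer G Q ?R" x] x(1) by simp
    have NB: "subgroup (normalizer ?B P) ?B"
      using h.H.normalizer_imp_subgroup P subgroup.subset by (auto simp: p_subgroup_def)
    interpret hD: group_hom "G\<lparr>carrier := ?D\<rparr>" "?B\<lparr>carrier := normalizer ?B P\<rparr>" ?h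
      using h.group_hom_restrict[OF D NB] norm by simp
    \<comment> \<open>Centralizing Q modulo \<open>?R\<close> implies centralizing it modulo the
      larger \<open>K\<close>, hence centralizing \<open>P\<close> in the quotient.\<close>
    have "K #> c \<in> centralizer ?B P" if c: "c \<in> section_centralizer G Q ?R" "c \<in> ?D" for c
    proof -
      have "c \<in> H" using c(2) DH by blast
      have "commutator_subgroup ?A Q c \<subseteq> K"
        using c(1) commutator_subgroup_restrict[OF H QH \<open>c \<in> H\<close>]
        by (simp add: section_centralizer_def)
      then show ?thesis
        using h.image_mem_centralizer_iff[of Q c] QH \<open>c \<in> H\<close> ker hQ by simp
    qed
    then show "p_radical_modulo p (?B\<lparr>carrier := normalizer ?B P\<rparr>) (centralizer ?B P) X"
      using hD.p_radical_modulo_image[OF rad] norm x(2) by simp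
  qed
qed

theorem proposition1p20:
  fixes G :: "('a, 'b) monoid_scheme" and p :: nat
  assumes "Factorial_Ring.prime p" and "odd p"
    and "group G" and "finite (carrier G)"
  shows "(section_p_stable p G \<longleftrightarrow> (\<forall>S \<in> sections G. p_stable p S)) \<and>
         ((\<forall>S \<in> sections G. p_stable p S) \<longleftrightarrow>
          (\<forall>R. p_subgroup p G R \<longrightarrow> p_stable p (G\<lparr>carrier := normalizer G R\<rparr> Mod R)))"
proof -
  interpret group G by fact
  have "\<forall>S \<in> sections G. p_stable p S" if "section_p_stable p G"
    using p_stable_section_if_section_p_stable[OF assms(1,4) that]
    by (auto simp: sections_def)
  \<comment> \<open>A subgroup is normal in its normalizer, so this quotient is one of the sections.
    The last implication then closes the cycle.\<close>
  moreover have "p_stable p (G\<lparr>carrier := normalizer G R\<rparr> Mod R)"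
    if "\<forall>S \<in> sections G. p_stable p S" "p_subgroup p G R" for R
  proof -
    have R: "subgroup R G" using that(2) by (simp add: p_subgroup_def)
    then have "G\<lparr>carrier := normalizer G R\<rparr> Mod R \<in> sections G"
      using subgroup_in_normalizer[OF R] normalizer_imp_subgroup[OF subgroup.subset[OF R]]
      unfolding sections_def by blast
    with that(1) show ?thesis by blast
  qed
  moreover have "section_p_stable p G"
    if "\<forall>R. p_subgroup p G R \<longrightarrow> p_stable p (G\<lparr>carrier := normalizer G R\<rparr> Mod R)"
    using section_p_stable_if_normalizer_quotients[OF assms(1,4)] that by blast
  ultimately show ?thesis by blast
qed

end
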